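(* For $i\in\{1,2,3\}$ let $f_{\gamma,i}$ be the density defined in the context, which satisfies $\int_{\mathbb R}t^2f_{\gamma,i}(t)\,dt=1$, and let $$\eta_i(\gamma)=\left[\left(\int_{\mathbb R}t^2f_{\gamma,i}(t)\,dt\right)\left(\int_{\mathbb R}\frac{(f_{\gamma,i}'(t))^2}{f_{\gamma,i}(t)}\,dt\right)\right]^{-1}$$ be the corresponding asymptotic relative efficiency of the maximum likelihood estimator with respect to the ordinary least squares estimator. Then $$\eta_1(\gamma)=\frac{\Gamma\left(\frac1\gamma\right)^2}{\gamma^2\,\Gamma\left(\frac3\gamma\right)\Gamma\left(2-\frac1\gamma\right)},\qquad\gamma\in(1/2,\infty),$$ $$\eta_2(\gamma)=\frac{\Gamma(\gamma)(\gamma-2)}{\Gamma(\gamma+2)},\qquad\gamma\in(2,\infty),$$ $$\eta_3(\gamma)=\frac{1}{\Gamma\left(\frac2\gamma+1\right)\Gamma\left(1-\frac2\gamma\right)(\gamma-1)^2},\qquad\gamma\in(2,\infty).$$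
   Context: $\Gamma(z)=\int_0^\infty t^{z-1}e^{-t}\,dt$ for $z>0$. The derivative $f'_{\gamma,i}$ is taken on $\mathbb R\setminus\{0\}$. The three families of symmetric densities on $\mathbb R$ are: 1. $f_{\gamma,1}(t)=d_\gamma\exp(-c_\gamma|t|^\gamma)$, $\gamma>0$, with $c_\gamma=\left(\frac{\Gamma(3/\gamma)}{\Gamma(1/\gamma)}\right)^{\gamma/2}$ and $d_\gamma=\frac\gamma2\left(\frac{\Gamma(3/\gamma)}{\Gamma(1/\gamma)^3}\right)^{1/2}$. 2. $f_{\gamma,2}(t)=d_\gamma|t|^{\gamma-1}\exp(-c_\gamma|t|)$, $\gamma\ge1$, with $c_\gamma=\left(\frac{\Gamma(\gamma+2)}{\Gamma(\gamma)}\right)^{1/2}$ and $d_\gamma=\frac1{2\Gamma(\gamma)}\left(\frac{\Gamma(\gamma+2)}{\Gamma(\gamma)}\right)^{\gamma/2}$. 3. $f_{\gamma,3}(t)=d_\gamma|t|^{\gamma-1}\exp(-c_\gamma|t|^\gamma)$, $\gamma\ge1$, with $c_\gamma=\Gamma\left(\frac2\gamma+1\right)^{\gamma/2}$ and $d_\gamma=\frac\gamma2\Gamma\left(\frac2\gamma+1\right)^{\gamma/2}$. (The constants $c_\gamma,d_\gamma$ depend on the family.) *)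

theory Defs
  imports "HOL-Probability.Probability"
begin

(* For positive arguments, the library function Gamma is Euler's integral: see Gamma_integral_real. *)

definition c1 :: "real \<Rightarrow> real" where
  "c1 \<gamma> = (Gamma (3 / \<gamma>) / Gamma (1 / \<gamma>)) powr (\<gamma> / 2)"

definition d1 :: "real \<Rightarrow> real" where
  "d1 \<gamma> = \<gamma> / 2 * sqrt (Gamma (3 / \<gamma>) / Gamma (1 / \<gamma>) ^ 3)"

definition f1 :: "real \<Rightarrow> real \<Rightarrow> real" where
  "f1 \<gamma> t = d1 \<gamma> * exp (- c1 \<gamma> * \<bar>t\<bar> powr \<gamma>)"

definition c2 :: "real \<Rightarrow> real" where
  "c2 \<gamma> = sqrt (Gamma (\<gamma> + 2) / Gamma \<gamma>)"

definition d2 :: "real \<Rightarrow> real" where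
  "d2 \<gamma> = 1 / (2 * Gamma \<gamma>) * (Gamma (\<gamma> + 2) / Gamma \<gamma>) powr (\<gamma> / 2)"

(* Since 0 powr 0 = 0, the functions f2 1 and f3 1 vanish at t = 0, where the convention 0^0 = 1
   would give d2 1 and d3 1. This changes one point only, hence no integral and no derivative
   on the complement of 0. *)

definition f2 :: "real \<Rightarrow> real \<Rightarrow> real" where
  "f2 \<gamma> t = d2 \<gamma> * \<bar>t\<bar> powr (\<gamma> - 1) * exp (- c2 \<gamma> * \<bar>t\<bar>)"

definition c3 :: "real \<Rightarrow> real" where
  "c3 \<gamma> = Gamma (2 / \<gamma> + 1) powr (\<gamma> / 2)"

definition d3 :: "real \<Rightarrow> real" where
  "d3 \<gamma> = \<gamma> / 2 * Gamma (2 / \<gamma> + 1) powr (\<gamma> / 2)"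

definition f3 :: "real \<Rightarrow> real \<Rightarrow> real" where
  "f3 \<gamma> t = d3 \<gamma> * \<bar>t\<bar> powr (\<gamma> - 1) * exp (- c3 \<gamma> * \<bar>t\<bar> powr \<gamma>)"

(* The point 0, where the densities need not be differentiable, is left out of the Fisher
   information integral. If either Bochner integral failed to exist, it would be 0 by convention
   and so would ARE f; a nonzero value of ARE f therefore entails that both integrals exist. *)

definition ARE :: "(real \<Rightarrow> real) \<Rightarrow> real" where
  "ARE f = inverse ((LBINT t. t\<^sup>2 * f t) * (LBINT t:-{0}. (deriv f t)\<^sup>2 / f t))"

definition standardized_density :: "(real \<Rightarrow> real) \<Rightarrow> bool" where
  "standardized_density f \<longleftrightarrow>
     (\<forall>t. 0 \<le> f t) \<and>
     has_bochner_integral lborel f 1 \<and>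
     has_bochner_integral lborel (\<lambda>t. t\<^sup>2 * f t) 1"

end

theory Submission imports Defs
begin

text \<open>
  All three families have the form f(t) = d |t|^a exp (- c |t|^b) off 0, with (a, b) equal to
  (0, \<gamma>), (\<gamma> - 1, 1) and (\<gamma> - 1, \<gamma>). The substitution y = c |t|^b turns every absolute moment of
  exp (- c |t|^b) into a Gamma value, and f'^2 / f is again a combination of such integrands, with
  exponents a - 2, a + b - 2 and a + 2b - 2. For a = 0 only the last survives; for a > 1 the
  functional equation of Gamma collapses the three terms into one.
\<close>

section \<open>Absolute moments of exp (- c |t|^b)\<close>

lemma has_bochner_integral_powr_exp_nonneg:
  fixes b c p :: real
  assumes b: "b > 0" and c: "c > 0" and p: "p > -1"
  shows "has_bochner_integral lborel (\<lambda>t. indicator {0..} t *\<^sub>R (\<bar>t\<bar> powr p * exp (- c * \<bar>t\<bar> powr b)))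
           (1 / b * c powr (- (p + 1) / b) * Gamma ((p + 1) / b))"
proof -
  define s where "s = (p + 1) / b"
  have s: "s > 0" using b p by (simp add: s_def)
  define h where "h = (\<lambda>y::real. y powr (s - 1) / exp y)"
  define g where "g = (\<lambda>x::real. c * x powr b)"
  define g' where "g' = (\<lambda>x::real. c * (b * x powr (b - 1)))"
  define k where "k = (\<lambda>t::real. indicator {0..} t *\<^sub>R (\<bar>t\<bar> powr p * exp (- c * \<bar>t\<bar> powr b)))"
  have "{x \<in> {0..} - {0<..}. h x \<noteq> 0} = {}" "{x \<in> {0<..} - {0..}. h x \<noteq> 0} = {}"
    by (auto simp: h_def)
  hence "(h has_integral Gamma s) {0..} \<longleftrightarrow> (h has_integral Gamma s) {0<..}"
    by (intro has_integral_spike_set_eq) (simp_all only: negligible_empty)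
  hence "(h has_integral Gamma s) {0<..}"
    using Gamma_integral_real[OF s] by (simp add: h_def)
  \<comment> \<open>The change of variables formula is about absolute integrability, which follows
    here from nonnegativity.\<close>
  moreover have "h absolutely_integrable_on {0<..}"
    using calculation by (intro nonnegative_absolutely_integrable_1) (auto simp: h_def integrable_on_def)
  moreover have "g ` {0<..} = {0<..}"
  proof (intro equalityI subsetI)
    fix y :: real assume y: "y \<in> {0<..}"
    have "y = g ((y / c) powr (1 / b))"
      using y b c by (simp add: g_def powr_powr)
    thus "y \<in> g ` {0<..}" using y c by (intro image_eqI[of _ _ "(y / c) powr (1 / b)"]) auto
  qed (use c in \<open>auto simp: g_def\<close>)
  moreover have "inj_on g {0<..}"
  proof (rule inj_onI)
    fix x y assume xy: "x \<in> {0<..}" "y \<in> {0<..}" "g x = g y"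
    hence "(x powr b) powr (1 / b) = (y powr b) powr (1 / b)" using c by (simp add: g_def)
    thus "x = y" using xy b by (simp add: powr_powr)
  qed
  moreover have "(g has_field_derivative g' x) (at x within {0<..})" if "x \<in> {0<..}" for x
    unfolding g_def g'_def
    by (intro DERIV_cmult has_field_derivative_at_within[OF has_real_derivative_powr]) (use that in auto)
  ultimately have int:
    "(\<lambda>x. \<bar>g' x\<bar> * h (g x)) absolutely_integrable_on {0<..}"
    "integral {0<..} (\<lambda>x. \<bar>g' x\<bar> * h (g x)) = Gamma s"
    using has_absolute_integral_change_of_variables_1'[of "{0<..}" g g' h "Gamma s"]
    by (auto simp: integral_unique)
  have leb: "has_bochner_integral lebesgue (\<lambda>x. indicator {0<..} x *\<^sub>R (\<bar>g' x\<bar> * h (g x))) (Gamma s)"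
    using int(1) set_lebesgue_integral_eq_integral(2)[OF int(1)] int(2)
    by (simp add: has_bochner_integral_iff set_integrable_def set_lebesgue_integral_def)
  have eq: "indicator {0<..} x *\<^sub>R (\<bar>g' x\<bar> * h (g x)) = (b * c powr s) * k x" for x :: real
  proof (cases "x > 0")
    case True
    \<comment> \<open>The powers of c and of x are kept apart: the exponents of x add up to (b - 1)
      + b (s - 1) = b s - 1 = p, those of c to s.\<close>
    have "\<bar>g' x\<bar> * h (g x) =
        b * (c powr 1 * c powr (s - 1)) * (x powr (b - 1) * x powr (b * (s - 1))) * exp (- (c * x powr b))"
      using True b c by (simp add: g'_def g_def h_def powr_mult powr_powr exp_minus abs_mult field_simps)
    also have "\<dots> = b * c powr s * x powr p * exp (- (c * x powr b))"
      using b by (subst (1 2) powr_add[symmetric]) (simp add: s_def field_simps)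
    finally show ?thesis using True by (simp add: k_def)
  \<comment> \<open>At x = 0 the two indicators differ, but \<open>k 0 = 0\<close> because
    \<open>0 powr p = 0\<close>, even for p = 0.\<close>
  qed (auto simp: k_def indicator_def not_less)
  have meas: "k \<in> borel_measurable lborel" unfolding k_def by measurable
  have "has_bochner_integral lebesgue (\<lambda>x. (b * c powr s) * k x) (Gamma s)"
    using leb unfolding eq .
  \<comment> \<open>Lebesgue measure is the completion of \<open>lborel\<close>; for the Borel
    function \<open>k\<close> both give the same integral.\<close>
  hence "has_bochner_integral lborel (\<lambda>x. (b * c powr s) * k x) (Gamma s)"
    using meas integrable_completion[of "\<lambda>x. (b * c powr s) * k x" lborel]
      integral_completion[of "\<lambda>x. (b * c powr s) * k x" lborel]
    unfolding has_bochner_integral_iff by simp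
  hence "has_bochner_integral lborel (\<lambda>x. 1 / (b * c powr s) * ((b * c powr s) * k x)) (1 / (b * c powr s) * Gamma s)"
    by (intro has_bochner_integral_mult_right)
  moreover have "1 / (b * c powr s) * ((b * c powr s) * k x) = k x" for x
    using b c by simp
  moreover have "1 / (b * c powr s) = 1 / b * c powr (- (p + 1) / b)"
    unfolding minus_divide_left[symmetric] s_def powr_minus by (simp add: divide_simps)
  ultimately show ?thesis unfolding k_def s_def by (simp only:)
qed

text \<open>The integrand is even, so the value on the half-line doubles.\<close>

lemma has_bochner_integral_powr_exp:
  fixes b c p :: real
  assumes "b > 0" "c > 0" "p > -1"
  shows "has_bochner_integral lborel (\<lambda>t. \<bar>t\<bar> powr p * exp (- c * \<bar>t\<bar> powr b))
           (2 / b * c powr (- (p + 1) / b) * Gamma ((p + 1) / b))"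
  using has_bochner_integral_even_function[OF has_bochner_integral_powr_exp_nonneg[OF assms]] by (simp add: mult.assoc)

section \<open>Moments and Fisher information of d |t|^a exp (- c |t|^b)\<close>

lemma has_bochner_integral_lborel_cong_except_0:
  fixes f g :: "real \<Rightarrow> real"
  assumes f: "has_bochner_integral lborel f x"
    and eq: "\<And>t. t \<noteq> 0 \<Longrightarrow> g t = f t"
  shows "has_bochner_integral lborel g x"
proof -
  \<comment> \<open>Overwriting a function at one point keeps it Borel measurable; comparing
    integrals almost everywhere asks for measurability of both functions.\<close>
  have "g = (\<lambda>t. if t = 0 then g 0 else f t)" using eq by auto
  moreover have "(\<lambda>t. if t = 0 then g 0 else f t) \<in> borel_measurable lborel"
    using borel_measurable_has_bochner_integral[OF f] by measurable
  ultimately have "g \<in> borel_measurable lborel" by simp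
  moreover have "AE t in lborel. f t = g t"
    using AE_lborel_singleton[of 0] by eventually_elim (simp add: eq)
  ultimately show ?thesis
    using f has_bochner_integral_cong_AE borel_measurable_has_bochner_integral by blast
qed

text \<open>The formula is imposed only off 0: for a = 0 it would give 0 at the origin, since
  \<open>0 powr 0 = 0\<close>, whereas \<open>f1 \<gamma> 0\<close> is
  \<open>d1 \<gamma>\<close>.\<close>

locale generalized_gamma_density =
  fixes a b c d :: real and f :: "real \<Rightarrow> real"
  assumes b: "b > 0" and c: "c > 0" and d: "d > 0"
    and f: "\<And>t. t \<noteq> 0 \<Longrightarrow> f t = d * \<bar>t\<bar> powr a * exp (- c * \<bar>t\<bar> powr b)"
begin

lemma moment0:
  assumes "a > -1"
  shows "has_bochner_integral lborel f (d * (2 / b * c powr (- (a + 1) / b) * Gamma ((a + 1) / b)))"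
  by (rule has_bochner_integral_lborel_cong_except_0[OF has_bochner_integral_mult_right])
     (use has_bochner_integral_powr_exp[OF b c assms] in \<open>auto simp: f\<close>)

lemma moment2:
  assumes "a > -1"
  shows "has_bochner_integral lborel (\<lambda>t. t\<^sup>2 * f t)
           (d * (2 / b * c powr (- (a + 3) / b) * Gamma ((a + 3) / b)))"
proof -
  have eq: "t\<^sup>2 * f t = d * (\<bar>t\<bar> powr (a + 2) * exp (- c * \<bar>t\<bar> powr b))" if "t \<noteq> 0" for t
    using that by (simp add: f powr_add powr_numeral[of "\<bar>t\<bar>"])
  show ?thesis
    by (rule has_bochner_integral_lborel_cong_except_0[OF has_bochner_integral_mult_right eq])
       (use has_bochner_integral_powr_exp[OF b c, of "a + 2"] assms in \<open>auto simp: add.assoc\<close>)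
qed

text \<open>With x = |t|, the logarithmic derivative of the density in x is (a - b c x^b) / x. Hence
  f'^2 / f = f (a - b c x^b)^2 / x^2, and expanding the square gives three integrands of the type
  already integrated.\<close>

lemma deriv_sq_over:
  assumes t: "t \<noteq> 0"
  shows "(deriv f t)\<^sup>2 / f t =
    d * (a\<^sup>2 * (\<bar>t\<bar> powr (a - 2) * exp (- c * \<bar>t\<bar> powr b))
       - 2 * a * b * c * (\<bar>t\<bar> powr (a + b - 2) * exp (- c * \<bar>t\<bar> powr b))
       + b\<^sup>2 * c\<^sup>2 * (\<bar>t\<bar> powr (a + 2 * b - 2) * exp (- c * \<bar>t\<bar> powr b)))"
proof -
  define x where "x = \<bar>t\<bar>"
  have x: "x > 0" using t by (simp add: x_def)
  define E where "E = exp (- c * x powr b)"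
  define X where "X = x powr a"
  define Y where "Y = x powr b"
  have X: "X > 0" using x by (simp add: X_def)
  have E: "E > 0" by (simp add: E_def)
  define D where "D = (\<lambda>x. d * (a * x powr (a - 1)) * exp (- c * x powr b) +
      d * x powr a * (exp (- c * x powr b) * (- c * (b * x powr (b - 1)))))"
  have base: "((\<lambda>x. d * x powr a * exp (- c * x powr b)) has_real_derivative D x) (at x)"
    unfolding D_def using x
    by (auto intro!: derivative_eq_intros has_real_derivative_powr)
  \<comment> \<open>Away from 0 the sign is locally constant, so |u| is the linear map
    \<open>sgn t * u\<close> near t.\<close>
  have abs: "(abs has_real_derivative sgn t) (at t)"
  proof -
    have "open {u. 0 < sgn t * u}"
      by (intro open_Collect_less continuous_intros)
    hence "\<forall>\<^sub>F u in nhds t. u \<in> {u. 0 < sgn t * u}"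
      by (rule eventually_nhds_in_open) (use t in \<open>simp add: sgn_if\<close>)
    hence "\<forall>\<^sub>F u in nhds t. \<bar>u\<bar> = sgn t * u"
      by eventually_elim (use t in \<open>auto simp: sgn_if zero_less_mult_iff split: if_splits\<close>)
    moreover have "((\<lambda>u. sgn t * u) has_real_derivative sgn t) (at t)"
      by (auto intro!: derivative_eq_intros)
    ultimately show ?thesis by (subst DERIV_cong_ev[OF refl _ refl])
  qed
  have "((\<lambda>t. d * \<bar>t\<bar> powr a * exp (- c * \<bar>t\<bar> powr b)) has_real_derivative D x * sgn t) (at t)"
    using DERIV_chain2[OF base[unfolded x_def] abs] by (simp add: x_def)
  moreover have "\<forall>\<^sub>F u in nhds t. f u = d * \<bar>u\<bar> powr a * exp (- c * \<bar>u\<bar> powr b)"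
    using t1_space_nhds[OF t] by eventually_elim (simp add: f)
  ultimately have "(f has_real_derivative D x * sgn t) (at t)"
    by (subst DERIV_cong_ev[OF refl _ refl])
  hence "deriv f t = D x * sgn t" by (rule DERIV_imp_deriv)
  \<comment> \<open>The sign disappears on squaring, so both half-lines are treated at once.\<close>
  hence "(deriv f t)\<^sup>2 = (D x)\<^sup>2"
    using t by (simp add: power_mult_distrib sgn_if)
  moreover have "D x = d * E * x powr a / x * (a - b * c * x powr b)"
  proof -
    have "x powr (a - 1) = x powr a / x" "x powr (b - 1) = x powr b / x"
      using x by (simp_all add: powr_diff)
    thus ?thesis unfolding D_def E_def[symmetric] using x by (simp add: field_simps)
  qed
  moreover have "f t = d * x powr a * E"
    using t by (simp add: f x_def E_def)
  ultimately have "(deriv f t)\<^sup>2 / f t = (d * E * X / x * (a - b * c * Y))\<^sup>2 / (d * X * E)"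
    by (simp add: X_def Y_def)
  also have "\<dots> = d * (a\<^sup>2 * (X / x\<^sup>2 * E) - 2 * a * b * c * (X * Y / x\<^sup>2 * E)
       + b\<^sup>2 * c\<^sup>2 * (X * Y\<^sup>2 / x\<^sup>2 * E))"
    using d E x X by (simp add: power2_eq_square field_simps)
  also have "X / x\<^sup>2 = x powr (a - 2)"
    using x by (simp add: X_def powr_diff powr_numeral)
  also have "X * Y / x\<^sup>2 = x powr (a + b - 2)"
    using x by (simp add: X_def Y_def powr_diff powr_add powr_numeral)
  also have "X * Y\<^sup>2 / x\<^sup>2 = x powr (a + 2 * b - 2)"
  proof -
    have "Y\<^sup>2 = x powr (2 * b)"
      using powr_add[of x b b] by (simp add: Y_def power2_eq_square)
    thus ?thesis using x by (simp add: X_def powr_diff powr_add powr_numeral)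
  qed
  finally show ?thesis by (simp add: x_def E_def)
qed

text \<open>Each integrand that occurs must have exponent above -1. For a > 1 the smallest exponent
  a - 2 is admissible, hence all are. For a = 0 the first two terms carry a factor a and vanish,
  leaving only 2b - 2 > -1.\<close>

lemma fisher_information:
  assumes "a = 0 \<and> 2 * b > 1 \<or> a > 1"
  defines "u \<equiv> (a - 1) / b"
  shows "(LBINT t:-{0}. (deriv f t)\<^sup>2 / f t) =
    2 * d / b * c powr (- u) * (a\<^sup>2 * Gamma u - 2 * a * b * Gamma (u + 1) + b\<^sup>2 * Gamma (u + 2))"
proof -
  let ?k = "\<lambda>p t. \<bar>t\<bar> powr p * exp (- c * \<bar>t\<bar> powr b)"
  let ?m = "\<lambda>i. 2 / b * c powr (- (u + i)) * Gamma (u + i)"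
  \<comment> \<open>Each further factor |t|^b raises the Gamma argument by one, starting from
    u.\<close>
  have shift: "(a + i * b - 2 + 1) / b = u + i" for i
    using b by (simp add: u_def field_simps)
  have int: "has_bochner_integral lborel (?k (a + i * b - 2)) (?m i)" if "a + i * b - 2 > -1" for i
    using has_bochner_integral_powr_exp[OF b c that] shift[of i]
    by (simp only: minus_divide_left[symmetric])
  have 0: "has_bochner_integral lborel (\<lambda>t. a\<^sup>2 * ?k (a - 2) t) (a\<^sup>2 * ?m 0)"
  \<comment> \<open>For a = 0 the power |t|^(-2) is not integrable at 0, but its coefficient makes
    the function identically zero, and the claimed value is 0 whatever \<open>Gamma u\<close>
    is.\<close>
  proof (cases "a = 0")
    case False
    thus ?thesis using assms int[of 0] by (intro has_bochner_integral_mult_right) simp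
  qed auto
  have 1: "has_bochner_integral lborel (\<lambda>t. 2 * a * b * c * ?k (a + b - 2) t) (2 * a * b * c * ?m 1)"
  proof (cases "a = 0")
    case False
    thus ?thesis using assms b int[of 1] by (intro has_bochner_integral_mult_right) simp
  qed auto
  have 2: "has_bochner_integral lborel (\<lambda>t. b\<^sup>2 * c\<^sup>2 * ?k (a + 2 * b - 2) t) (b\<^sup>2 * c\<^sup>2 * ?m 2)"
    using assms b int[of 2] by (intro has_bochner_integral_mult_right) auto
  have "has_bochner_integral lborel
      (\<lambda>t. d * (a\<^sup>2 * ?k (a - 2) t - 2 * a * b * c * ?k (a + b - 2) t + b\<^sup>2 * c\<^sup>2 * ?k (a + 2 * b - 2) t))
      (d * (a\<^sup>2 * ?m 0 - 2 * a * b * c * ?m 1 + b\<^sup>2 * c\<^sup>2 * ?m 2))" (is "has_bochner_integral _ _ ?R")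
    by (intro has_bochner_integral_mult_right has_bochner_integral_add has_bochner_integral_diff 0 1 2)
  from has_bochner_integral_lborel_cong_except_0[OF this]
  have "has_bochner_integral lborel (\<lambda>t. indicator (-{0}) t *\<^sub>R ((deriv f t)\<^sup>2 / f t)) ?R"
    using deriv_sq_over by simp
  hence "(LBINT t:-{0}. (deriv f t)\<^sup>2 / f t) = ?R"
    unfolding set_lebesgue_integral_def by (rule has_bochner_integral_integral_eq)
  \<comment> \<open>The coefficients c and c^2 in the second and third terms cancel against these
    shifts, so all three share \<open>c powr (- u)\<close>.\<close>
  also have "c powr (- (u + 1)) = c powr (- u) / c"
    using c by (simp add: powr_diff flip: diff_conv_add_uminus)
  also have "c powr (- (u + 2)) = c powr (- u) / c\<^sup>2"
    using c by (simp add: powr_diff powr_numeral flip: diff_conv_add_uminus)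
  finally show ?thesis using b c by (simp add: field_simps power2_eq_square)
qed

text \<open>Here u > 0, so the functional equation reduces all three values to
  \<open>Gamma u\<close>. Its coefficient is a^2 - 2abu + b^2 u (u + 1) = (a - bu)^2 + b^2 u, where
  a - bu = 1 and bu = a - 1.\<close>

lemma fisher_information_gt_1:
  assumes a: "a > 1"
  shows "(LBINT t:-{0}. (deriv f t)\<^sup>2 / f t) =
    2 * d / b * c powr (- ((a - 1) / b)) * Gamma ((a - 1) / b) * (1 + b * (a - 1))"
proof -
  define u where "u = (a - 1) / b"
  have u: "u > 0" using a b by (simp add: u_def)
  have G1: "Gamma (u + 1) = u * Gamma u"
    using Gamma_plus1[of u] u by (simp add: nonpos_Ints_def)
  have G2: "Gamma (u + 2) = (u + 1) * u * Gamma u"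
    using Gamma_plus1[of "u + 1"] u G1 by (auto simp: nonpos_Ints_def add.assoc)
  have bu: "a = b * u + 1" using b by (simp add: u_def)
  have "a\<^sup>2 * Gamma u - 2 * a * b * Gamma (u + 1) + b\<^sup>2 * Gamma (u + 2) = Gamma u * (1 + b * (a - 1))"
    unfolding G1 G2 bu by (simp add: algebra_simps power2_eq_square)
  with fisher_information a show ?thesis by (simp add: u_def)
qed

end

section \<open>The three families and their constants\<close>

lemma generalized_gamma_density_f1:
  assumes "\<gamma> > 0"
  shows "generalized_gamma_density 0 \<gamma> (c1 \<gamma>) (d1 \<gamma>) (f1 \<gamma>)"
  using assms by unfold_locales (auto simp: f1_def c1_def d1_def Gamma_real_pos[THEN less_imp_neq, symmetric])

lemma generalized_gamma_density_f2:
  assumes "\<gamma> > 0"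
  shows "generalized_gamma_density (\<gamma> - 1) 1 (c2 \<gamma>) (d2 \<gamma>) (f2 \<gamma>)"
  using assms Gamma_real_pos[of \<gamma>] Gamma_real_pos[of "\<gamma> + 2"]
  by unfold_locales (auto simp: f2_def c2_def d2_def simp del: Gamma_real_pos intro!: divide_pos_pos)

lemma generalized_gamma_density_f3:
  assumes "\<gamma> > 0"
  shows "generalized_gamma_density (\<gamma> - 1) \<gamma> (c3 \<gamma>) (d3 \<gamma>) (f3 \<gamma>)"
proof -
  have "0 < Gamma (2 / \<gamma> + 1)" using assms by (intro Gamma_real_pos add_pos_pos) auto
  thus ?thesis using assms by unfold_locales (auto simp: f3_def c3_def d3_def)
qed

text \<open>The constant \<open>c1 \<gamma>\<close> is r^\<gamma> for r = sqrt (Gamma (3/\<gamma>) /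
  Gamma (1/\<gamma>)), so the exponents over \<gamma> in the moment formulas become plain powers of
  r.\<close>

lemma c1_powr:
  assumes "\<gamma> > 0"
  shows "c1 \<gamma> powr (x / \<gamma>) = sqrt (Gamma (3 / \<gamma>) / Gamma (1 / \<gamma>)) powr x"
  using assms by (simp add: c1_def powr_powr powr_half_sqrt[symmetric] less_imp_le)

text \<open>Taking the square of Gamma (1/\<gamma>) out of the root expresses
  \<open>d1 \<gamma>\<close> through the same r.\<close>

lemma d1_eq:
  assumes "\<gamma> > 0"
  shows "d1 \<gamma> = \<gamma> / 2 * sqrt (Gamma (3 / \<gamma>) / Gamma (1 / \<gamma>)) / Gamma (1 / \<gamma>)"
proof -
  have "Gamma (3 / \<gamma>) / Gamma (1 / \<gamma>) ^ 3 = Gamma (3 / \<gamma>) / Gamma (1 / \<gamma>) / (Gamma (1 / \<gamma>))\<^sup>2"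
    by (simp add: power2_eq_square power3_eq_cube)
  hence "sqrt (Gamma (3 / \<gamma>) / Gamma (1 / \<gamma>) ^ 3)
         = sqrt (Gamma (3 / \<gamma>) / Gamma (1 / \<gamma>)) / Gamma (1 / \<gamma>)"
    using assms by (simp only: real_sqrt_divide real_sqrt_abs) (simp add: less_imp_le)
  thus ?thesis by (simp add: d1_def)
qed

lemma c2_square:
  assumes "\<gamma> > 0"
  shows "(c2 \<gamma>)\<^sup>2 = Gamma (\<gamma> + 2) / Gamma \<gamma>"
  using assms by (simp add: c2_def less_imp_le)

lemma d2_eq:
  assumes "\<gamma> > 0"
  shows "d2 \<gamma> = c2 \<gamma> powr \<gamma> / (2 * Gamma \<gamma>)"
  using assms by (simp add: d2_def c2_def powr_half_sqrt[symmetric] powr_powr less_imp_le)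

lemma c3_powr:
  assumes "\<gamma> > 0"
  shows "c3 \<gamma> powr (2 / \<gamma>) = Gamma (2 / \<gamma> + 1)"
  using assms Gamma_real_pos[of "2 / \<gamma> + 1"] by (simp add: c3_def powr_powr add_pos_pos)

lemma d3_eq: "d3 \<gamma> = \<gamma> / 2 * c3 \<gamma>"
  by (simp add: d3_def c3_def)

section \<open>Unit mass and unit second moment\<close>

lemma standardized_density_f1:
  assumes g: "\<gamma> > 0"
  shows "standardized_density (f1 \<gamma>)"
proof -
  interpret generalized_gamma_density 0 \<gamma> "c1 \<gamma>" "d1 \<gamma>" "f1 \<gamma>"
    by (rule generalized_gamma_density_f1[OF g])
  define A where "A = Gamma (1 / \<gamma>)"
  define B where "B = Gamma (3 / \<gamma>)"
  define r where "r = sqrt (B / A)"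
  have A: "A > 0" and B: "B > 0" using g by (simp_all add: A_def B_def)
  hence r: "r > 0" by (simp add: r_def)
  have r2: "r ^ 2 = B / A" using A B by (simp add: r_def)
  have cp: "c1 \<gamma> powr (x / \<gamma>) = r powr x" for x
    unfolding r_def A_def B_def by (rule c1_powr[OF g])
  have dd: "d1 \<gamma> = \<gamma> / 2 * r / A"
    unfolding r_def A_def B_def by (rule d1_eq[OF g])
  have "r powr -3 = inverse (r ^ 3)" using r by (simp add: powr_minus powr_numeral)
  hence "d1 \<gamma> * (2 / \<gamma> * c1 \<gamma> powr (- (0 + 3) / \<gamma>) * Gamma ((0 + 3) / \<gamma>))
        = \<gamma> / 2 * r / A * (2 / \<gamma> * inverse (r ^ 3) * B)"
    using cp[of "-3"] by (simp add: dd B_def)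
  \<comment> \<open>The moment is r r^(-3) B / A, which is 1 by the choice of r.\<close>
  also have "\<dots> = B / A / r ^ 2"
    using r g A by (simp add: field_simps power2_eq_square power3_eq_cube)
  finally have m2: "d1 \<gamma> * (2 / \<gamma> * c1 \<gamma> powr (- (0 + 3) / \<gamma>) * Gamma ((0 + 3) / \<gamma>)) = 1"
    using r2 A B by simp
  have "r powr -1 = inverse r" using r by (simp add: powr_minus)
  hence m0: "d1 \<gamma> * (2 / \<gamma> * c1 \<gamma> powr (- (0 + 1) / \<gamma>) * Gamma ((0 + 1) / \<gamma>)) = 1"
    using r g cp[of "-1"] dd A by (simp add: A_def[symmetric])
  have "0 \<le> f1 \<gamma> t" for t using d by (simp add: f1_def)
  with moment0[unfolded m0] moment2[unfolded m2] show ?thesis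
    by (simp add: standardized_density_def)
qed

lemma standardized_density_f2:
  assumes g: "\<gamma> > 0"
  shows "standardized_density (f2 \<gamma>)"
proof -
  interpret generalized_gamma_density "\<gamma> - 1" 1 "c2 \<gamma>" "d2 \<gamma>" "f2 \<gamma>"
    by (rule generalized_gamma_density_f2[OF g])
  have G: "Gamma \<gamma> > 0" "Gamma (\<gamma> + 2) > 0" using g by simp_all
  have m0: "d2 \<gamma> * (2 / 1 * c2 \<gamma> powr (- (\<gamma> - 1 + 1) / 1) * Gamma ((\<gamma> - 1 + 1) / 1)) = 1"
    using c G by (simp add: d2_eq[OF g] powr_minus)
  have e: "- (\<gamma> - 1 + 3) / 1 = - (\<gamma> + 2)" "(\<gamma> - 1 + 3) / 1 = \<gamma> + 2" by simp_all
  \<comment> \<open>The first factor cancels against \<open>d2 \<gamma>\<close>; the second is the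
    ratio Gamma (\<gamma> + 2) / Gamma \<gamma> and absorbs the Gamma values that remain.\<close>
  have h: "c2 \<gamma> powr (- (\<gamma> - 1 + 3) / 1) = inverse (c2 \<gamma> powr \<gamma> * (c2 \<gamma>)\<^sup>2)"
    unfolding e powr_minus using c by (simp add: powr_add powr_numeral)
  have m2: "d2 \<gamma> * (2 / 1 * c2 \<gamma> powr (- (\<gamma> - 1 + 3) / 1) * Gamma ((\<gamma> - 1 + 3) / 1)) = 1"
    unfolding h unfolding e d2_eq[OF g] c2_square[OF g] using c less_imp_neq[OF G(1)] less_imp_neq[OF G(2)] by simp
  have "0 \<le> f2 \<gamma> t" for t using d by (simp add: f2_def)
  with moment0[unfolded m0] moment2[unfolded m2] g show ?thesis
    by (simp add: standardized_density_def)
qed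

lemma standardized_density_f3:
  assumes g: "\<gamma> > 0"
  shows "standardized_density (f3 \<gamma>)"
proof -
  interpret generalized_gamma_density "\<gamma> - 1" \<gamma> "c3 \<gamma>" "d3 \<gamma>" "f3 \<gamma>"
    by (rule generalized_gamma_density_f3[OF g])
  have G: "Gamma (2 / \<gamma> + 1) > 0" using g by (simp add: add_pos_pos)
  have m0: "d3 \<gamma> * (2 / \<gamma> * c3 \<gamma> powr (- (\<gamma> - 1 + 1) / \<gamma>) * Gamma ((\<gamma> - 1 + 1) / \<gamma>)) = 1"
    using c g by (simp add: d3_eq powr_minus)
  have e: "(\<gamma> - 1 + 3) / \<gamma> = 2 / \<gamma> + 1" using g by (simp add: field_simps)
  \<comment> \<open>The exponent (\<gamma> + 2) / \<gamma> splits as 2/\<gamma> + 1: one part gives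
    exactly the Gamma value of the moment, the other cancels the \<open>c3 \<gamma>\<close> in
    \<open>d3 \<gamma>\<close>.\<close>
  have h: "c3 \<gamma> powr (- (\<gamma> - 1 + 3) / \<gamma>) = inverse (Gamma (2 / \<gamma> + 1) * c3 \<gamma>)"
    unfolding minus_divide_left[symmetric] e powr_minus using c by (simp add: powr_add c3_powr[OF g])
  have m2: "d3 \<gamma> * (2 / \<gamma> * c3 \<gamma> powr (- (\<gamma> - 1 + 3) / \<gamma>) * Gamma ((\<gamma> - 1 + 3) / \<gamma>)) = 1"
    unfolding h unfolding e using c g less_imp_neq[OF G] by (simp add: d3_eq field_simps)
  have "0 \<le> f3 \<gamma> t" for t using d by (simp add: f3_def)
  with moment0[unfolded m0] moment2[unfolded m2] g show ?thesis
    by (simp add: standardized_density_def)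
qed

section \<open>The asymptotic relative efficiencies\<close>

lemma ARE_standardized_density:
  assumes "standardized_density f"
  shows "ARE f = inverse (LBINT t:-{0}. (deriv f t)\<^sup>2 / f t)"
  using assms by (simp add: ARE_def standardized_density_def has_bochner_integral_integral_eq)

lemma ARE_f1:
  assumes g: "\<gamma> > 1/2"
  shows "ARE (f1 \<gamma>) = (Gamma (1 / \<gamma>))\<^sup>2 / (\<gamma>\<^sup>2 * Gamma (3 / \<gamma>) * Gamma (2 - 1 / \<gamma>))"
proof -
  have g0: "\<gamma> > 0" using g by simp
  interpret generalized_gamma_density 0 \<gamma> "c1 \<gamma>" "d1 \<gamma>" "f1 \<gamma>"
    by (rule generalized_gamma_density_f1[OF g0])
  have G: "Gamma (1 / \<gamma>) > 0" "Gamma (3 / \<gamma>) > 0" using g0 by simp_all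
  define r where "r = sqrt (Gamma (3 / \<gamma>) / Gamma (1 / \<gamma>))"
  have "r > 0" using G by (simp add: r_def)
  have r2: "r * r = Gamma (3 / \<gamma>) / Gamma (1 / \<gamma>)" using G by (simp add: r_def)
  \<comment> \<open>Here a = 0, b = \<gamma> and u = -1/\<gamma>, so only the term with Gamma (u +
    2) survives; \<gamma> > 1/2 is the condition 2b > 1.\<close>
  have "(LBINT t:-{0}. (deriv (f1 \<gamma>) t)\<^sup>2 / f1 \<gamma> t)
        = 2 * d1 \<gamma> / \<gamma> * c1 \<gamma> powr (1 / \<gamma>) * (\<gamma>\<^sup>2 * Gamma (2 - 1 / \<gamma>))"
    using fisher_information g by simp
  also have "\<dots> = (r * r) / Gamma (1 / \<gamma>) * (\<gamma>\<^sup>2 * Gamma (2 - 1 / \<gamma>))"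
    using c1_powr[OF g0, of 1] d1_eq[OF g0] g0 \<open>r > 0\<close> by (simp add: r_def[symmetric])
  finally show ?thesis
    using ARE_standardized_density[OF standardized_density_f1[OF g0]] unfolding r2
    by (simp add: power2_eq_square field_simps)
qed

lemma ARE_f2:
  assumes g: "\<gamma> > 2"
  shows "ARE (f2 \<gamma>) = Gamma \<gamma> * (\<gamma> - 2) / Gamma (\<gamma> + 2)"
proof -
  have g0: "\<gamma> > 0" using g by simp
  interpret generalized_gamma_density "\<gamma> - 1" 1 "c2 \<gamma>" "d2 \<gamma>" "f2 \<gamma>"
    by (rule generalized_gamma_density_f2[OF g0])
  have G: "Gamma \<gamma> > 0" "Gamma (\<gamma> + 2) > 0" "Gamma (\<gamma> - 2) > 0" using g by simp_all
  have "Gamma (\<gamma> - 1) = (\<gamma> - 2) * Gamma (\<gamma> - 2)" "Gamma \<gamma> = (\<gamma> - 1) * Gamma (\<gamma> - 1)"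
    using g Gamma_plus1[of "\<gamma> - 2"] Gamma_plus1[of "\<gamma> - 1"] by (auto simp: nonpos_Ints_def)
  hence G2: "Gamma \<gamma> = (\<gamma> - 1) * (\<gamma> - 2) * Gamma (\<gamma> - 2)" by simp
  \<comment> \<open>With a = \<gamma> - 1 and b = 1, the condition a > 1 reads \<gamma> > 2, and the
    factor 1 + b (a - 1) is \<gamma> - 1.\<close>
  have "(LBINT t:-{0}. (deriv (f2 \<gamma>) t)\<^sup>2 / f2 \<gamma> t)
        = 2 * d2 \<gamma> * c2 \<gamma> powr (2 - \<gamma>) * Gamma (\<gamma> - 2) * (\<gamma> - 1)"
    using fisher_information_gt_1 g by simp
  also have "\<dots> = (c2 \<gamma>)\<^sup>2 * (Gamma (\<gamma> - 2) * (\<gamma> - 1) / Gamma \<gamma>)"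
    using c by (simp add: d2_eq[OF g0] powr_diff)
  also have "Gamma (\<gamma> - 2) * (\<gamma> - 1) / Gamma \<gamma> = 1 / (\<gamma> - 2)"
    unfolding G2 using less_imp_neq[OF G(3)] g by simp
  finally show ?thesis
    using ARE_standardized_density[OF standardized_density_f2[OF g0]] unfolding c2_square[OF g0] by simp
qed

lemma ARE_f3:
  assumes g: "\<gamma> > 2"
  shows "ARE (f3 \<gamma>) = 1 / (Gamma (2 / \<gamma> + 1) * Gamma (1 - 2 / \<gamma>) * (\<gamma> - 1)\<^sup>2)"
proof -
  have g0: "\<gamma> > 0" using g by simp
  interpret generalized_gamma_density "\<gamma> - 1" \<gamma> "c3 \<gamma>" "d3 \<gamma>" "f3 \<gamma>"
    by (rule generalized_gamma_density_f3[OF g0])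
  have G: "Gamma (2 / \<gamma> + 1) > 0" using g0 by (simp add: add_pos_pos)
  have e: "(\<gamma> - 1 - 1) / \<gamma> = 1 - 2 / \<gamma>" using g by (simp add: field_simps)
  have "(LBINT t:-{0}. (deriv (f3 \<gamma>) t)\<^sup>2 / f3 \<gamma> t)
        = 2 * d3 \<gamma> / \<gamma> * c3 \<gamma> powr (- (1 - 2 / \<gamma>)) * Gamma (1 - 2 / \<gamma>) * (1 + \<gamma> * (\<gamma> - 1 - 1))"
    using fisher_information_gt_1 g unfolding e by simp
  \<comment> \<open>For b = \<gamma> and a = \<gamma> - 1 the factor 1 + b (a - 1) is a perfect
    square.\<close>
  also have "1 + \<gamma> * (\<gamma> - 1 - 1) = (\<gamma> - 1)\<^sup>2" by (simp add: power2_eq_square algebra_simps)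
  also have "c3 \<gamma> powr (- (1 - 2 / \<gamma>)) = Gamma (2 / \<gamma> + 1) / c3 \<gamma>"
    using c by (simp add: powr_diff c3_powr[OF g0])
  finally show ?thesis
    using ARE_standardized_density[OF standardized_density_f3[OF g0]] c g0
    by (simp add: d3_eq field_simps)
qed

theorem mainTheorem5:
  "(\<forall>\<gamma>>0. standardized_density (f1 \<gamma>)) \<and>
   (\<forall>\<gamma>\<ge>1. standardized_density (f2 \<gamma>)) \<and>
   (\<forall>\<gamma>\<ge>1. standardized_density (f3 \<gamma>)) \<and>
   (\<forall>\<gamma>>1/2. ARE (f1 \<gamma>) =
      (Gamma (1 / \<gamma>))\<^sup>2 / (\<gamma>\<^sup>2 * Gamma (3 / \<gamma>) * Gamma (2 - 1 / \<gamma>))) \<and>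
   (\<forall>\<gamma>>2. ARE (f2 \<gamma>) = Gamma \<gamma> * (\<gamma> - 2) / Gamma (\<gamma> + 2)) \<and>
   (\<forall>\<gamma>>2. ARE (f3 \<gamma>) =
      1 / (Gamma (2 / \<gamma> + 1) * Gamma (1 - 2 / \<gamma>) * (\<gamma> - 1)\<^sup>2))"
  by (auto intro: standardized_density_f1 standardized_density_f2 standardized_density_f3
      ARE_f1 ARE_f2 ARE_f3)

end
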